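(* There exists a matching market with resource-regional caps in which no matching is both direct-envy stable and seat-efficient.
   Context: A matching market with resource-regional caps consists of: finite sets $\mathcal{S}$ (students), $\mathcal{C}$ (colleges), $\mathcal{R}$ (non-empty resources), and an additional empty resource $r_0$, with $\mathcal{R}_0=\mathcal{R}\cup\{r_0\}$; a quota $q_c>0$ for each $c\in\mathcal{C}$; for each $r\in\mathcal{R}$ a non-empty region $C_r\subseteq\mathcal{C}$ (regions may overlap) and a cap $q_r>0$; by convention $C_{r_0}=\mathcal{C}$ and $q_{r_0}=|\mathcal{S}|$; for each college $c$ a strict ranking $\succ_c$ of $\mathcal{S}$; for each student $s$ a strict ranking $\succ_s$ of $(\mathcal{C}\times\mathcal{R}_0)\cup\{\emptyset\}$. A pair $(c,r)$ is acceptable for $s$ if $(c,r)\succ_s\emptyset$. It is assumed that whenever $r\in\mathcal{R}$ and $(c,r)$ is acceptable for $s$, $(c,r)\succ_s(c,r_0)$. The set of contracts is $\mathcal{X}=\mathcal{S}\times\mathcal{C}\times\mathcal{R}_0$. A matching $\mu$ is a subset of $\mathcal{X}$ in which each student appears in at most one contract; $\mu_s$ denotes the contract of $s$ in $\mu$ (also identified with its college-resource pair), with $\mu_s=\emptyset$ if $s$ is unmatched (and then $\mu\setminus\{\mu_s\}=\mu$). $\mu$ is feasible if each college $c$ is in at most $q_c$ contracts of $\mu$, and for each $r\in\mathcal{R}$ at most $q_r$ contracts of $\mu$ contain $r$, all of them with colleges in $C_r$. $\mu$ is individually rational if $(c,r)\succ_s\emptyset$ for each $(s,c,r)\in\mu$.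 Let $\mu$ be feasible and individually rational. - $(s,c,r)\in\mathcal{X}\setminus\mu$ envy-blocks $\mu$ through $(s',c,r')\in\mu$ if $(c,r)\succ_s\mu_s$, $s\succ_c s'$, and $(\mu\setminus\{\mu_s,(s',c,r')\})\cup\{(s,c,r)\}$ is feasible. It direct-envy-blocks $\mu$ if it envy-blocks $\mu$ through some $(s',c,r')\in\mu$ with $r\in\{r',r_0\}$. - $(s,c,r)\in\mathcal{X}\setminus\mu$ waste-blocks $\mu$ if $(c,r)\succ_s\mu_s$ and $(\mu\setminus\{\mu_s\})\cup\{(s,c,r)\}$ is feasible. A waste-blocking contract $(s,c,r)$ is seat-blocking if $s$ is not already admitted to $c$ under $\mu$. $\mu$ is seat-efficient if it has no seat-blocking contracts. - A waste-blocking contract $(s,c,r)$ is dominated if there is a contract $(s',c,r')\in\mathcal{X}\setminus\mu$ (same college $c$) that is neither waste-blocking nor direct-envy-blocking under $\mu$, but is direct-envy-blocking under $(\mu\setminus\{\mu_s\})\cup\{(s,c,r)\}$. A feasible individually rational matching is direct-envy stable if it has no direct-envy-blocking contracts and every waste-blocking contract is dominated. *)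

theory Defs
  imports Main
begin

text \<open>
  Resources range over \<^typ>\<open>'r option\<close>: \<^term>\<open>Some r\<close> is a non-empty resource and
  \<^const>\<open>None\<close> is the empty resource \<open>r\<^sub>0\<close>. Students rank the elements of type
  \<^typ>\<open>('c \<times> 'r option) option\<close>, where the outer \<^const>\<open>None\<close> is the option \<open>\<emptyset>\<close> of staying
  unmatched. In both kinds of rankings \<open>(x, y)\<close> belongs to the relation iff \<open>x\<close> is strictly
  preferred to \<open>y\<close>.
\<close>

record ('s, 'c, 'r) market =
  students :: "'s set"
  colleges :: "'c set"
  resources :: "'r set"
  quota :: "'c \<Rightarrow> nat"
  region :: "'r \<Rightarrow> 'c set"
  cap :: "'r \<Rightarrow> nat"
  college_pref :: "'c \<Rightarrow> ('s \<times> 's) set"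
  student_pref :: "'s \<Rightarrow> (('c \<times> 'r option) option \<times> ('c \<times> 'r option) option) set"

type_synonym ('s, 'c, 'r) contract = "'s \<times> 'c \<times> 'r option"

definition resources0 :: "('s, 'c, 'r) market \<Rightarrow> 'r option set" where
  "resources0 M = insert None (Some ` resources M)"

definition strict_ranking_on :: "'a set \<Rightarrow> ('a \<times> 'a) set \<Rightarrow> bool" where
  "strict_ranking_on A r \<longleftrightarrow> r \<subseteq> A \<times> A \<and> strict_linear_order_on A r"

definition college_prefers :: "('s, 'c, 'r) market \<Rightarrow> 'c \<Rightarrow> 's \<Rightarrow> 's \<Rightarrow> bool" where
  "college_prefers M c s s' \<longleftrightarrow> (s, s') \<in> college_pref M c"

definition student_prefers ::
    "('s, 'c, 'r) market \<Rightarrow> 's \<Rightarrow> ('c \<times> 'r option) option \<Rightarrow> ('c \<times> 'r option) option \<Rightarrow> bool" where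
  "student_prefers M s x y \<longleftrightarrow> (x, y) \<in> student_pref M s"

definition acceptable :: "('s, 'c, 'r) market \<Rightarrow> 's \<Rightarrow> 'c \<times> 'r option \<Rightarrow> bool" where
  "acceptable M s p \<longleftrightarrow> student_prefers M s (Some p) None"

text \<open>
  The conventions \<open>C\<^bsub>r\<^sub>0\<^esub> = \<C>\<close> and \<open>q\<^bsub>r\<^sub>0\<^esub> = |\<S>|\<close> for the empty resource impose no
  constraint on a matching, so regions and caps are recorded for non-empty resources only.
\<close>

definition matching_market :: "('s, 'c, 'r) market \<Rightarrow> bool" where
  "matching_market M \<longleftrightarrow>
     finite (students M) \<and> finite (colleges M) \<and> finite (resources M) \<and>
     (\<forall>c\<in>colleges M. quota M c > 0) \<and>
     (\<forall>r\<in>resources M. region M r \<noteq> {} \<and> region M r \<subseteq> colleges M \<and> cap M r > 0) \<and>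
     (\<forall>c\<in>colleges M. strict_ranking_on (students M) (college_pref M c)) \<and>
     (\<forall>s\<in>students M.
        strict_ranking_on (insert None (Some ` (colleges M \<times> resources0 M))) (student_pref M s)) \<and>
     (\<forall>s\<in>students M. \<forall>c\<in>colleges M. \<forall>r\<in>resources M.
        acceptable M s (c, Some r) \<longrightarrow> student_prefers M s (Some (c, Some r)) (Some (c, None)))"

definition contracts :: "('s, 'c, 'r) market \<Rightarrow> ('s, 'c, 'r) contract set" where
  "contracts M = students M \<times> colleges M \<times> resources0 M"

definition matching :: "('s, 'c, 'r) market \<Rightarrow> ('s, 'c, 'r) contract set \<Rightarrow> bool" where
  "matching M \<mu> \<longleftrightarrow> \<mu> \<subseteq> contracts M \<and> (\<forall>x\<in>\<mu>. \<forall>y\<in>\<mu>. fst x = fst y \<longrightarrow> x = y)"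

definition contract_of ::
    "('s, 'c, 'r) contract set \<Rightarrow> 's \<Rightarrow> ('s, 'c, 'r) contract option" where
  "contract_of \<mu> s =
     (if \<exists>x\<in>\<mu>. fst x = s then Some (THE x. x \<in> \<mu> \<and> fst x = s) else None)"

definition assignment :: "('s, 'c, 'r) contract set \<Rightarrow> 's \<Rightarrow> ('c \<times> 'r option) option" where
  "assignment \<mu> s = map_option snd (contract_of \<mu> s)"

definition feasible :: "('s, 'c, 'r) market \<Rightarrow> ('s, 'c, 'r) contract set \<Rightarrow> bool" where
  "feasible M \<mu> \<longleftrightarrow>
     matching M \<mu> \<and>
     (\<forall>c\<in>colleges M. card {(s, c', r) \<in> \<mu>. c' = c} \<le> quota M c) \<and>
     (\<forall>r\<in>resources M.
        card {(s, c, r') \<in> \<mu>. r' = Some r} \<le> cap M r \<and>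
        (\<forall>s c. (s, c, Some r) \<in> \<mu> \<longrightarrow> c \<in> region M r))"

definition individually_rational ::
    "('s, 'c, 'r) market \<Rightarrow> ('s, 'c, 'r) contract set \<Rightarrow> bool" where
  "individually_rational M \<mu> \<longleftrightarrow> (\<forall>(s, c, r)\<in>\<mu>. acceptable M s (c, r))"

text \<open>
  For a matching \<open>\<mu>\<close>, the set \<^term>\<open>set_option (contract_of \<mu> s)\<close> is \<open>{\<mu>\<^sub>s}\<close> if \<open>s\<close> is
  matched and empty otherwise.
\<close>

definition envy_blocks_through ::
    "('s, 'c, 'r) market \<Rightarrow> ('s, 'c, 'r) contract set \<Rightarrow>
     ('s, 'c, 'r) contract \<Rightarrow> ('s, 'c, 'r) contract \<Rightarrow> bool" where
  "envy_blocks_through M \<mu> = (\<lambda>(s, c, r) (s', c', r').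
     (s, c, r) \<in> contracts M - \<mu> \<and> (s', c', r') \<in> \<mu> \<and> c' = c \<and>
     student_prefers M s (Some (c, r)) (assignment \<mu> s) \<and>
     college_prefers M c s s' \<and>
     feasible M ((\<mu> - (set_option (contract_of \<mu> s) \<union> {(s', c', r')})) \<union> {(s, c, r)}))"

definition direct_envy_blocks ::
    "('s, 'c, 'r) market \<Rightarrow> ('s, 'c, 'r) contract set \<Rightarrow> ('s, 'c, 'r) contract \<Rightarrow> bool" where
  "direct_envy_blocks M \<mu> = (\<lambda>(s, c, r).
     \<exists>s' r'. envy_blocks_through M \<mu> (s, c, r) (s', c, r') \<and> r \<in> {r', None})"

definition waste_blocks ::
    "('s, 'c, 'r) market \<Rightarrow> ('s, 'c, 'r) contract set \<Rightarrow> ('s, 'c, 'r) contract \<Rightarrow> bool" where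
  "waste_blocks M \<mu> = (\<lambda>(s, c, r).
     (s, c, r) \<in> contracts M - \<mu> \<and>
     student_prefers M s (Some (c, r)) (assignment \<mu> s) \<and>
     feasible M ((\<mu> - set_option (contract_of \<mu> s)) \<union> {(s, c, r)}))"

definition seat_blocks ::
    "('s, 'c, 'r) market \<Rightarrow> ('s, 'c, 'r) contract set \<Rightarrow> ('s, 'c, 'r) contract \<Rightarrow> bool" where
  "seat_blocks M \<mu> = (\<lambda>(s, c, r).
     waste_blocks M \<mu> (s, c, r) \<and> (\<nexists>r'. (s, c, r') \<in> \<mu>))"

definition seat_efficient ::
    "('s, 'c, 'r) market \<Rightarrow> ('s, 'c, 'r) contract set \<Rightarrow> bool" where
  "seat_efficient M \<mu> \<longleftrightarrow> (\<nexists>x. seat_blocks M \<mu> x)"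

definition dominated ::
    "('s, 'c, 'r) market \<Rightarrow> ('s, 'c, 'r) contract set \<Rightarrow> ('s, 'c, 'r) contract \<Rightarrow> bool" where
  "dominated M \<mu> = (\<lambda>(s, c, r).
     \<exists>s' r'. (s', c, r') \<in> contracts M - \<mu> \<and>
       \<not> waste_blocks M \<mu> (s', c, r') \<and>
       \<not> direct_envy_blocks M \<mu> (s', c, r') \<and>
       direct_envy_blocks M ((\<mu> - set_option (contract_of \<mu> s)) \<union> {(s, c, r)}) (s', c, r'))"

definition direct_envy_stable ::
    "('s, 'c, 'r) market \<Rightarrow> ('s, 'c, 'r) contract set \<Rightarrow> bool" where
  "direct_envy_stable M \<mu> \<longleftrightarrow>
     feasible M \<mu> \<and> individually_rational M \<mu> \<and>
     (\<nexists>x. direct_envy_blocks M \<mu> x) \<and>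
     (\<forall>x. waste_blocks M \<mu> x \<longrightarrow> dominated M \<mu> x)"

end

theory Submission
  imports Defs
begin

text \<open>
  Two students compete for one unit of a resource that two colleges share, and only contracts with
  that resource are acceptable. Student \<open>s\<close> prefers college \<open>s\<close>, while college \<open>c\<close> prefers the
  student other than \<open>c\<close>. An acceptable feasible matching has at most one contract. If there is
  none, seats are wasted; if the unit is used at its owner's second choice, moving it along to the
  first choice is a seat-blocking contract; if it is used at the owner's first choice, that college
  prefers the other student, who has direct envy. So the unit cycles for ever.
\<close>

fun ranking :: "'a list \<Rightarrow> ('a \<times> 'a) set" where
  "ranking [] = {}"
| "ranking (x # xs) = {x} \<times> set xs \<union> ranking xs"

lemma ranking_subset: "ranking xs \<subseteq> set xs \<times> set xs"
  by (induction xs) auto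

lemma strict_ranking_on_ranking:
  assumes "distinct xs"
  shows "strict_ranking_on (set xs) (ranking xs)"
  using assms
proof (induction xs)
  case Nil
  show ?case
    by (simp add: strict_ranking_on_def strict_linear_order_on_def)
next
  case (Cons x xs)
  then have "trans (ranking xs)" "irrefl (ranking xs)" "total_on (set xs) (ranking xs)"
    by (auto simp: strict_ranking_on_def strict_linear_order_on_def)
  \<comment> \<open>No pair of the tail's ranking ends in \<open>x\<close>, so adding the pairs that
    start at \<open>x\<close> keeps the relation irreflexive and transitive.\<close>
  moreover have "x \<notin> set xs"
    using Cons.prems by simp
  ultimately show ?case
    using ranking_subset[of xs]
    unfolding strict_ranking_on_def strict_linear_order_on_def
    by (auto simp: irrefl_def total_on_def intro!: transI dest: transD)
qed

lemma contract_of_empty [simp]: "contract_of {} s = None"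
  by (simp add: contract_of_def)

lemma contract_of_singleton [simp]:
  "contract_of {x} s = (if fst x = s then Some x else None)"
  by (auto simp: contract_of_def)

text \<open>Students and colleges share the names 0 and 1, so that \<open>1 - s\<close> swaps them
  and one argument covers both students. Contracts without the resource rank below
  \<open>None\<close>, hence are unacceptable, yet below those with it, as a market
  requires.\<close>

definition cyclic_market :: "(nat, nat, nat) market" where
  "cyclic_market = \<lparr>
     students = {0, 1}, colleges = {0, 1}, resources = {0},
     quota = (\<lambda>_. 1), region = (\<lambda>_. {0, 1}), cap = (\<lambda>_. 1),
     college_pref = (\<lambda>c. ranking [1 - c, c]),
     student_pref = (\<lambda>s. ranking
       [Some (s, Some 0), Some (1 - s, Some 0), None, Some (s, None), Some (1 - s, None)])\<rparr>"

lemma matching_market_cyclic: "matching_market cyclic_market"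
proof -
  have "strict_ranking_on {0, 1} (ranking [1 - c, c])" if "c \<in> {0, 1}" for c :: nat
  proof -
    have "set [1 - c, c] = {0, 1}" "distinct [1 - c, c]"
      using that by auto
    then show ?thesis
      using strict_ranking_on_ranking by metis
  qed
  moreover have "strict_ranking_on
      (insert None (Some ` ({0, 1} \<times> {None, Some 0})))
      (ranking [Some (s, Some (0::nat)), Some (1 - s, Some 0), None, Some (s, None),
        Some (1 - s, None)])" (is "strict_ranking_on ?A (ranking ?xs)")
    if "s \<in> {0, 1}" for s :: nat
  proof -
    have "set ?xs = ?A" "distinct ?xs"
      using that by auto
    then show ?thesis
      using strict_ranking_on_ranking by metis
  qed
  ultimately show ?thesis
    by (auto simp: matching_market_def cyclic_market_def resources0_def acceptable_def
        student_prefers_def)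
qed

text \<open>Each blocking move below results in such a singleton, so this covers the feasibility
  condition of all of them.\<close>

lemma feasible_cyclic_singleton:
  assumes "s \<in> {0, 1}" "c \<in> {0, 1}"
  shows "feasible cyclic_market {(s, c, Some 0)}"
proof -
  \<comment> \<open>The arbitrary \<open>P\<close> lets one bound serve both the quotas and the
    cap.\<close>
  have card: "card {(s', c', r') \<in> {(s, c, Some 0)}. P s' c' r'} \<le> 1"
    for P :: "nat \<Rightarrow> nat \<Rightarrow> nat option \<Rightarrow> bool"
    by (rule order.trans[OF card_mono[of "{(s, c, Some 0)}"]]) auto
  have "quota cyclic_market c' = 1" "cap cyclic_market r = 1" "region cyclic_market r = {0, 1}"
    for c' r
    by (simp_all add: cyclic_market_def)
  moreover have "matching cyclic_market {(s, c, Some 0)}"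
    using assms by (auto simp: matching_def contracts_def cyclic_market_def resources0_def)
  ultimately show ?thesis
    unfolding feasible_def using assms(2) card by (intro conjI ballI) (simp_all only:, auto)
qed

text \<open>Individual rationality forces every contract to use the only resource, so its cap of 1
  bounds the whole matching.\<close>

lemma feasible_cyclic_cases:
  assumes feas: "feasible cyclic_market \<mu>" and ir: "individually_rational cyclic_market \<mu>"
  obtains "\<mu> = {}" | s c where "s \<in> {0, 1}" "c \<in> {0, 1}" "\<mu> = {(s, c, Some 0)}"
proof (cases "\<mu> = {}")
  case False
  have sub: "\<mu> \<subseteq> {0, 1} \<times> {0, 1} \<times> {None, Some 0}"
    using feas by (auto simp: feasible_def matching_def contracts_def cyclic_market_def
        resources0_def)
  then have fin: "finite \<mu>"
    by (rule finite_subset) simp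
  have res: "r = Some 0" if "(s, c, r) \<in> \<mu>" for s c r
  proof -
    have "acceptable cyclic_market s (c, r)"
      using ir that by (auto simp: individually_rational_def)
    then show ?thesis
      by (auto simp: acceptable_def student_prefers_def cyclic_market_def)
  qed
  then have "{(s, c, r') \<in> \<mu>. r' = Some 0} = \<mu>"
    by auto
  then have "card \<mu> \<le> 1"
    using feas by (auto simp: feasible_def cyclic_market_def)
  with False fin have "card \<mu> = 1"
    by (simp add: le_Suc_eq)
  then obtain x where x: "\<mu> = {x}"
    by (rule card_1_singletonE)
  obtain s c r where scr: "x = (s, c, r)"
    by (cases x)
  show thesis
    using that(2)[of s c] sub res[of s c r] unfolding x scr by auto
qed (use that in blast)

lemmas cyclic_simps = contracts_def resources0_def student_prefers_def college_prefers_def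
  assignment_def cyclic_market_def

lemma cyclic_empty_seat_blocks: "seat_blocks cyclic_market {} (0, 0, Some 0)"
  using feasible_cyclic_singleton[of 0 0]
  by (simp add: seat_blocks_def waste_blocks_def cyclic_simps)

text \<open>Student \<open>s\<close> releases the unit on moving, so the cap still holds, and
  college \<open>s\<close> is empty.\<close>

lemma cyclic_second_choice_seat_blocks:
  assumes "s \<in> {0, 1}"
  shows "seat_blocks cyclic_market {(s, 1 - s, Some 0)} (s, s, Some 0)"
  using assms feasible_cyclic_singleton[of s s]
  by (auto simp: seat_blocks_def waste_blocks_def cyclic_simps)

text \<open>Evicting \<open>s\<close> frees the seat and the unit at once; the envy is direct
  because both contracts use the same resource.\<close>

lemma cyclic_first_choice_direct_envy_blocks:
  assumes "s \<in> {0, 1}"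
  shows "direct_envy_blocks cyclic_market {(s, s, Some 0)} (1 - s, s, Some 0)"
  using assms feasible_cyclic_singleton[of "1 - s" s]
  by (auto simp: direct_envy_blocks_def envy_blocks_through_def cyclic_simps)

theorem proposition3:
  shows "\<exists>M :: (nat, nat, nat) market. matching_market M \<and>
           (\<nexists>\<mu>. matching M \<mu> \<and> direct_envy_stable M \<mu> \<and> seat_efficient M \<mu>)"
proof -
  have False if stable: "direct_envy_stable cyclic_market \<mu>"
    and efficient: "seat_efficient cyclic_market \<mu>" for \<mu>
  proof -
    have "feasible cyclic_market \<mu>" "individually_rational cyclic_market \<mu>"
      using stable by (auto simp: direct_envy_stable_def)
    then show False
    proof (cases rule: feasible_cyclic_cases)
      case 1
      then show False
        using efficient cyclic_empty_seat_blocks by (auto simp: seat_efficient_def)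
    next
      case (2 s c)
      \<comment> \<open>On {0, 1} these are the first and the second choice of
        \<open>s\<close>.\<close>
      then consider "c = s" | "c = 1 - s"
        by auto
      then show False
      proof cases
        case 1
        then show False
          using 2 stable cyclic_first_choice_direct_envy_blocks
          by (auto simp: direct_envy_stable_def)
      next
        case second: 2
        then show False
          using 2 efficient cyclic_second_choice_seat_blocks by (auto simp: seat_efficient_def)
      qed
    qed
  qed
  then show ?thesis
    using matching_market_cyclic by blast
qed

end
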